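(* Every finite tangled closure algebra $(A,\mathbf{C}^t_A)$ is isomorphic (as a tangled closure algebra) to $(A_S,\mathbf{C}^t_R)$ for some finite quasi-ordered set $(S,R)$.
   Context: A Boolean algebra $A$ has operations $\land,\lor,-,0,1$; $a\Rightarrow b=-a\lor b$. A closure operator on $A$ is $\mathbf{C}:A\to A$ with $\mathbf{C}(a\lor b)=\mathbf{C}a\lor\mathbf{C}b$, $\mathbf{C}0=0$, $a\leq\mathbf{C}a=\mathbf{C}\mathbf{C}a$; interior $\mathbf{I}a=-\mathbf{C}-a$. $\mathcal{P}_{fin}A$ is the set of finite non-empty subsets of $A$. For $\mathbf{C}^t:\mathcal{P}_{fin}A\to A$, the induced $\mathbf{C}a=\mathbf{C}^t\{a\}$, $\mathbf{I}a=-\mathbf{C}^t\{-a\}$; $(A,\mathbf{C}^t)$ is a tangled closure algebra if $\mathbf{C}$ is a closure operator and for all $\varGamma\in\mathcal{P}_{fin}A$, $a\in A$: (Fix) $\mathbf{C}^t\varGamma\leq\bigwedge_{\gamma\in\varGamma}\mathbf{C}(\gamma\land\mathbf{C}^t\varGamma)$; (Ind) $\mathbf{I}(a\Rightarrow\bigwedge_{\gamma\in\varGamma}\mathbf{C}(\gamma\land a))\land a\leq\mathbf{C}^t\varGamma$. An isomorphism of tangled closure algebras is a Boolean isomorphism $f$ with $f(\mathbf{C}^t_A\varGamma)=\mathbf{C}^t_B\{f\gamma:\gamma\in\varGamma\}$. For a quasi-ordered set $(S,R)$ ($R$ reflexive and transitive), $A_S$ is the powerset Boolean algebra of $S$, $\mathbf{C}_R(a)=R^{-1}(a)=\{x:\exists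 y\,(xRy\text{ and }y\in a)\}$, and $\mathbf{C}^t_R\varGamma=\bigcup\{a\subseteq S: a\subseteq\bigcap_{\gamma\in\varGamma}R^{-1}(\gamma\cap a)\}$. *)

theory Defs
  imports Main
begin

definition closure_operator :: "('a::boolean_algebra \<Rightarrow> 'a) \<Rightarrow> bool" where
  "closure_operator C \<longleftrightarrow>
     (\<forall>a b. C (sup a b) = sup (C a) (C b)) \<and>
     C bot = bot \<and>
     (\<forall>a. a \<le> C a \<and> C a = C (C a))"

definition bimp :: "'a::boolean_algebra \<Rightarrow> 'a \<Rightarrow> 'a" where
  "bimp a b = sup (- a) b"

definition Pfin :: "'a set \<Rightarrow> 'a set set" where
  "Pfin A = {\<Gamma>. \<Gamma> \<subseteq> A \<and> finite \<Gamma> \<and> \<Gamma> \<noteq> {}}"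

text \<open>A map on the finite non-empty subsets of \<open>'a\<close> is represented by a total function on
  \<open>'a set\<close>; its values outside \<open>Pfin UNIV\<close> are irrelevant in everything below.\<close>

definition ind_closure :: "('a::boolean_algebra set \<Rightarrow> 'a) \<Rightarrow> 'a \<Rightarrow> 'a" where
  "ind_closure Ct a = Ct {a}"

definition ind_interior :: "('a::boolean_algebra set \<Rightarrow> 'a) \<Rightarrow> 'a \<Rightarrow> 'a" where
  "ind_interior Ct a = - Ct {- a}"

locale tangled_closure_algebra =
  fixes Ct :: "'a::boolean_algebra set \<Rightarrow> 'a"
  assumes closure: "closure_operator (ind_closure Ct)"
    and Fix: "\<Gamma> \<in> Pfin UNIV \<Longrightarrow>
      Ct \<Gamma> \<le> Inf_fin ((\<lambda>\<gamma>. ind_closure Ct (inf \<gamma> (Ct \<Gamma>))) ` \<Gamma>)"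
    and Ind: "\<Gamma> \<in> Pfin UNIV \<Longrightarrow>
      inf (ind_interior Ct (bimp a (Inf_fin ((\<lambda>\<gamma>. ind_closure Ct (inf \<gamma> a)) ` \<Gamma>)))) a \<le> Ct \<Gamma>"

definition tangled_closure_rel :: "'s set \<Rightarrow> 's rel \<Rightarrow> 's set set \<Rightarrow> 's set" where
  "tangled_closure_rel S R \<Gamma> = \<Union>{a. a \<subseteq> S \<and> a \<subseteq> (\<Inter>\<gamma>\<in>\<Gamma>. R\<inverse> `` (\<gamma> \<inter> a))}"

text \<open>The powerset algebra of \<open>S\<close> has carrier \<open>Pow S\<close>, with complement taken relative to \<open>S\<close>;
  \<open>S\<close> is a set rather than a type because it is existentially quantified and may be empty
  (for the one-element Boolean algebra).\<close>

definition boolean_iso_powerset :: "'s set \<Rightarrow> ('a::boolean_algebra \<Rightarrow> 's set) \<Rightarrow> bool" where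
  "boolean_iso_powerset S f \<longleftrightarrow>
     bij_betw f UNIV (Pow S) \<and>
     (\<forall>a b. f (inf a b) = f a \<inter> f b) \<and>
     (\<forall>a b. f (sup a b) = f a \<union> f b) \<and>
     (\<forall>a. f (- a) = S - f a) \<and>
     f bot = {} \<and>
     f top = S"

definition tangled_iso_powerset ::
  "('a::boolean_algebra set \<Rightarrow> 'a) \<Rightarrow> 's set \<Rightarrow> 's rel \<Rightarrow> ('a \<Rightarrow> 's set) \<Rightarrow> bool" where
  "tangled_iso_powerset Ct S R f \<longleftrightarrow>
     boolean_iso_powerset S f \<and>
     (\<forall>\<Gamma>\<in>Pfin UNIV. f (Ct \<Gamma>) = tangled_closure_rel S R (f ` \<Gamma>))"

end

theory Submission
  imports Defs
begin

text \<open>\<open>S\<close> is the set of atoms of the algebra, with \<open>x R y\<close> iff \<open>x \<le> C y\<close>, and \<open>f a\<close> is the set of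
  atoms below \<open>a\<close>. Additivity of \<open>C\<close> makes \<open>f\<close> carry \<open>C\<close> to \<open>R\<inverse>\<close>. In any tangled closure algebra
  \<open>C\<^sup>t \<Gamma>\<close> is the greatest \<open>a\<close> with \<open>a \<le> C (\<gamma> \<and> a)\<close> for all \<open>\<gamma> \<in> \<Gamma>\<close>, so it is determined by \<open>C\<close>
  and the order, and is therefore preserved by \<open>f\<close> as well.\<close>

definition atom :: "'a::boolean_algebra \<Rightarrow> bool" where
  "atom x \<longleftrightarrow> x \<noteq> bot \<and> (\<forall>y\<le>x. y = bot \<or> y = x)"

definition atoms_below :: "'a::boolean_algebra \<Rightarrow> 'a set" where
  "atoms_below a = {x. atom x \<and> x \<le> a}"

text \<open>Since \<open>inf x a\<close> lies below the atom \<open>x\<close>, it is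
  \<open>bot\<close> or \<open>x\<close>; these cases say \<open>x \<le> - a\<close> and
  \<open>x \<le> a\<close> respectively.\<close>

lemma atom_le_compl_iff:
  assumes "atom x"
  shows "x \<le> - a \<longleftrightarrow> \<not> x \<le> a"
proof -
  have "inf x a = bot \<or> inf x a = x"
    using assms by (simp add: atom_def)
  then show ?thesis
    using assms by (metis atom_def inf.absorb_iff1 inf_shunt)
qed

text \<open>Atoms are join-prime: De Morgan turns the join into a meet of complements, and each
  complement negates membership below.\<close>

lemma atom_le_sup_iff:
  assumes "atom x"
  shows "x \<le> sup a b \<longleftrightarrow> x \<le> a \<or> x \<le> b"
proof -
  have "x \<le> - sup a b \<longleftrightarrow> x \<le> - a \<and> x \<le> - b"
    by simp
  then show ?thesis
    unfolding atom_le_compl_iff[OF assms] by blast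
qed

lemma atoms_below_bot: "atoms_below bot = {}"
  by (auto simp: atoms_below_def atom_def bot_unique)

lemma atoms_below_inf: "atoms_below (inf a b) = atoms_below a \<inter> atoms_below b"
  by (auto simp: atoms_below_def)

lemma atoms_below_sup: "atoms_below (sup a b) = atoms_below a \<union> atoms_below b"
  by (auto simp: atoms_below_def atom_le_sup_iff)

lemma atoms_below_compl: "atoms_below (- a) = Collect atom - atoms_below a"
  by (auto simp: atoms_below_def atom_le_compl_iff)

lemma atoms_below_atom: "atom x \<Longrightarrow> atoms_below x = {x}"
  by (auto simp: atoms_below_def atom_def)

text \<open>Finiteness enters here: a minimal element among the nonzero elements below
  \<open>a\<close> is an atom.\<close>

lemma ex_atom_below:
  fixes a :: "'a::{boolean_algebra,finite}"
  assumes "a \<noteq> bot"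
  shows "\<exists>x. atom x \<and> x \<le> a"
proof -
  obtain m where m: "m \<noteq> bot" "m \<le> a" "\<And>y. y \<noteq> bot \<Longrightarrow> y \<le> a \<Longrightarrow> y \<le> m \<Longrightarrow> m = y"
    using finite_has_minimal[of "{x. x \<noteq> bot \<and> x \<le> a}"] assms by auto
  then have "atom m"
    unfolding atom_def by (metis order.trans)
  with m(2) show ?thesis by blast
qed

text \<open>If \<open>a \<le> b\<close> fails, then \<open>inf a (- b)\<close> is nonzero, and an
  atom below it lies below \<open>a\<close> but not below \<open>b\<close>.\<close>

lemma atoms_below_subset_iff:
  fixes a b :: "'a::{boolean_algebra,finite}"
  shows "atoms_below a \<subseteq> atoms_below b \<longleftrightarrow> a \<le> b"
proof
  assume sub: "atoms_below a \<subseteq> atoms_below b"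
  have "inf a (- b) = bot"
  proof (rule ccontr)
    assume "inf a (- b) \<noteq> bot"
    then obtain x where "atom x" "x \<le> a" "x \<le> - b"
      using ex_atom_below by (metis le_inf_iff)
    with sub show False
      by (auto simp: atoms_below_def atom_le_compl_iff)
  qed
  then show "a \<le> b"
    by (simp add: inf_shunt)
qed (auto simp: atoms_below_def)

lemma atoms_below_eq_iff:
  fixes a b :: "'a::{boolean_algebra,finite}"
  shows "atoms_below a = atoms_below b \<longleftrightarrow> a = b"
  by (metis antisym atoms_below_subset_iff order_refl)

lemma ex_atoms_below_eq:
  fixes T :: "'a::{boolean_algebra,finite} set"
  assumes "T \<subseteq> Collect atom"
  shows "\<exists>a. atoms_below a = T"
proof -
  have "finite T" by simp
  then show ?thesis using assms
  proof (induction T rule: finite_induct)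
    case empty
    show ?case using atoms_below_bot by blast
  next
    case (insert x T)
    then obtain a where "atoms_below a = T" "atom x" by auto
    \<comment> \<open>The witness is the join of the atoms in the set, built up one atom at a
      time.\<close>
    then have "atoms_below (sup x a) = insert x T"
      by (simp add: atoms_below_sup atoms_below_atom)
    then show ?case by blast
  qed
qed

lemma boolean_iso_powerset_atoms_below:
  "boolean_iso_powerset (Collect atom)
     (atoms_below :: 'a::{boolean_algebra,finite} \<Rightarrow> 'a set)"
proof -
  have "bij_betw (atoms_below :: 'a \<Rightarrow> 'a set) UNIV (Pow (Collect atom))"
  proof (rule bij_betw_imageI)
    show "inj (atoms_below :: 'a \<Rightarrow> 'a set)"
      by (simp add: inj_on_def atoms_below_eq_iff)
    show "range (atoms_below :: 'a \<Rightarrow> 'a set) = Pow (Collect atom)"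
      using ex_atoms_below_eq by (auto simp: atoms_below_def image_iff) blast
  qed
  moreover have "atoms_below (top :: 'a) = Collect atom"
    by (simp add: atoms_below_def)
  ultimately show ?thesis
    by (simp add: boolean_iso_powerset_def atoms_below_inf atoms_below_sup
        atoms_below_compl atoms_below_bot)
qed

definition atom_rel :: "('a::boolean_algebra \<Rightarrow> 'a) \<Rightarrow> 'a rel" where
  "atom_rel C = {(x, y). atom x \<and> atom y \<and> x \<le> C y}"

lemma closure_operator_mono:
  assumes "closure_operator C" and "a \<le> b"
  shows "C a \<le> C b"
  using assms unfolding closure_operator_def by (metis sup.absorb_iff2)

text \<open>Reflexivity is \<open>x \<le> C x\<close>. For transitivity, monotonicity and
  idempotence give \<open>x \<le> C y \<le> C (C z) = C z\<close>.\<close>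

lemma preorder_on_atom_rel:
  assumes "closure_operator C"
  shows "preorder_on (Collect atom) (atom_rel C)"
proof -
  have "x \<le> C z" if "x \<le> C y" "y \<le> C z" for x y z
    using that closure_operator_mono[OF assms, of y "C z"] assms
    unfolding closure_operator_def by (metis order.trans)
  then have "trans (atom_rel C)"
    unfolding trans_def atom_rel_def by blast
  moreover have "refl_on (Collect atom) (atom_rel C)"
    using assms by (auto simp: refl_on_def atom_rel_def closure_operator_def)
  ultimately show ?thesis
    by (auto simp: preorder_on_def atom_rel_def)
qed

text \<open>Both sides turn finite joins into unions and agree on atoms by the definition of
  \<open>atom_rel\<close>, and every element is a finite join of atoms.\<close>

lemma atoms_below_closure:
  fixes C :: "'a::{boolean_algebra,finite} \<Rightarrow> 'a"
  assumes C: "closure_operator C"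
  shows "atoms_below (C a) = (atom_rel C)\<inverse> `` atoms_below a"
proof -
  \<comment> \<open>The induction runs over sets of atoms and carries along the element
    \<open>b\<close> representing \<open>T\<close>. For \<open>T = atoms_below a\<close>,
    injectivity of \<open>atoms_below\<close> identifies \<open>b\<close> with
    \<open>a\<close>.\<close>
  have "\<exists>b. atoms_below b = T \<and> atoms_below (C b) = (atom_rel C)\<inverse> `` T"
    if "T \<subseteq> Collect atom" for T
  proof -
    have "finite T" by simp
    then show ?thesis using that
    proof (induction T rule: finite_induct)
      case empty
      have "C bot = bot"
        using C by (simp add: closure_operator_def)
      then show ?case
        using atoms_below_bot by (intro exI[of _ bot]) auto
    next
      case (insert x T)
      then obtain b where b: "atoms_below b = T" "atoms_below (C b) = (atom_rel C)\<inverse> `` T"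
        and x: "atom x" by auto
      have "C (sup x b) = sup (C x) (C b)"
        using C by (simp add: closure_operator_def)
      moreover have "atoms_below (C x) = (atom_rel C)\<inverse> `` {x}"
        using x by (auto simp: atoms_below_def atom_rel_def)
      ultimately have "atoms_below (C (sup x b)) = (atom_rel C)\<inverse> `` insert x T"
        using b by (auto simp: atoms_below_sup)
      moreover have "atoms_below (sup x b) = insert x T"
        using b x by (simp add: atoms_below_sup atoms_below_atom)
      ultimately show ?case by blast
    qed
  qed
  moreover have "atoms_below a \<subseteq> Collect atom"
    by (auto simp: atoms_below_def)
  ultimately show ?thesis
    by (metis atoms_below_eq_iff)
qed

context tangled_closure_algebra
begin

lemma Ct_postfixed:
  assumes "\<Gamma> \<in> Pfin UNIV" "\<gamma> \<in> \<Gamma>"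
  shows "Ct \<Gamma> \<le> ind_closure Ct (inf \<gamma> (Ct \<Gamma>))"
  using Fix[OF assms(1)] assms
  by (auto simp: Pfin_def intro: order.trans Inf_fin.coboundedI)

text \<open>The assumption on \<open>a\<close> makes the implication inside the interior in
  \<open>Ind\<close> equal to \<open>top\<close>. As \<open>top\<close> is its own interior,
  \<open>Ind\<close> collapses to the claim.\<close>

lemma Ct_greatest:
  assumes \<Gamma>: "\<Gamma> \<in> Pfin UNIV"
    and a: "\<And>\<gamma>. \<gamma> \<in> \<Gamma> \<Longrightarrow> a \<le> ind_closure Ct (inf \<gamma> a)"
  shows "a \<le> Ct \<Gamma>"
proof -
  have "a \<le> Inf_fin ((\<lambda>\<gamma>. ind_closure Ct (inf \<gamma> a)) ` \<Gamma>)"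
    using \<Gamma> a by (intro Inf_fin.boundedI) (auto simp: Pfin_def)
  then have "bimp a (Inf_fin ((\<lambda>\<gamma>. ind_closure Ct (inf \<gamma> a)) ` \<Gamma>)) = top"
    unfolding bimp_def by (metis sup_shunt double_compl)
  moreover have "ind_interior Ct top = top"
    using closure by (simp add: ind_interior_def closure_operator_def ind_closure_def)
  ultimately show ?thesis
    using Ind[OF \<Gamma>, of a] by simp
qed

end

theorem theorem3p1:
  fixes Ct :: "'a::{boolean_algebra,finite} set \<Rightarrow> 'a"
  assumes "tangled_closure_algebra Ct"
  shows "\<exists>(S :: 'a set) (R :: 'a rel) f.
           finite S \<and> preorder_on S R \<and> tangled_iso_powerset Ct S R f"
proof -
  interpret tangled_closure_algebra Ct by fact
  let ?S = "Collect atom :: 'a set" and ?C = "ind_closure Ct"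
  let ?R = "atom_rel ?C"
  \<comment> \<open>Being a post-fixed point transfers between the two algebras, because
    \<open>atoms_below\<close> preserves meets and closure and both preserves and reflects the
    order.\<close>
  have postfixed_iff:
    "atoms_below a \<subseteq> (\<Inter>\<gamma>\<in>atoms_below ` \<Gamma>. ?R\<inverse> `` (\<gamma> \<inter> atoms_below a))
      \<longleftrightarrow> (\<forall>\<gamma>\<in>\<Gamma>. a \<le> ?C (inf \<gamma> a))" for a \<Gamma>
    by (simp add: atoms_below_closure[OF closure, symmetric] atoms_below_inf[symmetric]
        le_INF_iff atoms_below_subset_iff)
  have "atoms_below (Ct \<Gamma>) = tangled_closure_rel ?S ?R (atoms_below ` \<Gamma>)"
    if \<Gamma>: "\<Gamma> \<in> Pfin UNIV" for \<Gamma>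
  proof
    have "atoms_below (Ct \<Gamma>) \<subseteq> ?S"
      by (auto simp: atoms_below_def)
    moreover have "atoms_below (Ct \<Gamma>)
        \<subseteq> (\<Inter>\<gamma>\<in>atoms_below ` \<Gamma>. ?R\<inverse> `` (\<gamma> \<inter> atoms_below (Ct \<Gamma>)))"
      unfolding postfixed_iff using Ct_postfixed[OF \<Gamma>] by blast
    ultimately show "atoms_below (Ct \<Gamma>) \<subseteq> tangled_closure_rel ?S ?R (atoms_below ` \<Gamma>)"
      unfolding tangled_closure_rel_def by blast
  next
    have "T \<subseteq> atoms_below (Ct \<Gamma>)"
      if "T \<subseteq> ?S" and T: "T \<subseteq> (\<Inter>\<gamma>\<in>atoms_below ` \<Gamma>. ?R\<inverse> `` (\<gamma> \<inter> T))" for T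
    proof -
      \<comment> \<open>Surjectivity is essential here: every set competing in the union comes from
        an element of the algebra, to which \<open>Ct_greatest\<close> applies.\<close>
      obtain a where a: "T = atoms_below a"
        using ex_atoms_below_eq[OF \<open>T \<subseteq> ?S\<close>] by blast
      then have "a \<le> Ct \<Gamma>"
        using T Ct_greatest[OF \<Gamma>] unfolding a postfixed_iff by blast
      then show ?thesis
        by (simp add: a atoms_below_subset_iff)
    qed
    then show "tangled_closure_rel ?S ?R (atoms_below ` \<Gamma>) \<subseteq> atoms_below (Ct \<Gamma>)"
      unfolding tangled_closure_rel_def by (intro Union_least) simp
  qed
  then have "tangled_iso_powerset Ct ?S ?R atoms_below"
    by (simp add: tangled_iso_powerset_def boolean_iso_powerset_atoms_below)
  with preorder_on_atom_rel[OF closure] show ?thesis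
    by (intro exI[of _ ?S] exI[of _ ?R] exI[of _ atoms_below]) simp
qed

end
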